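(* Let $X$ be a real Banach space which is not isomorphic to a Hilbert space, and let $T:X\to X^\ast$ be a positive linear operator (defined on all of $X$). If there exists $c>0$ such that $$\|T^\ast x\|\leq c\|Tx\|\quad\text{for all }x\in X,$$ then $\cos T=0$.
   Context: $X^\ast$ is the (topological) dual of $X$ and $\langle x^\ast,x\rangle=x^\ast(x)$. "Isomorphic" means linearly homeomorphic. A linear operator $T:X\to X^\ast$ is positive if $\langle Tx,x\rangle\geq 0$ for all $x\in X$ (such an everywhere defined operator is automatically bounded). $T^\ast:X\to X^\ast$ denotes the restriction to $X$ (canonically embedded in $X^{\ast\ast}$) of the adjoint of $T$, i.e. $\langle T^\ast x,y\rangle=\langle Ty,x\rangle$ for all $x,y\in X$. The cosine of a positive linear operator $T:X\to X^\ast$ is $$\cos T=\inf\left\{\frac{\langle Tx,x\rangle}{\|Tx\|\,\|x\|}\;:\; 0\neq x\in X,\ Tx\neq 0\right\}.$$ *)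

theory Defs
  imports "HOL-Analysis.Analysis"
begin

text \<open>Quantifying over all Hilbert spaces inside a formula is impossible with the type class
  \<open>{real_inner, complete_space}\<close>, so a Hilbert space is here a carrier set with explicit operations.\<close>

locale real_hilbert_space =
  fixes H :: "'h set"
    and add :: "'h \<Rightarrow> 'h \<Rightarrow> 'h"
    and zero :: "'h"
    and smul :: "real \<Rightarrow> 'h \<Rightarrow> 'h"
    and ip :: "'h \<Rightarrow> 'h \<Rightarrow> real"
    and d :: "'h \<Rightarrow> 'h \<Rightarrow> real"
  assumes add_closed: "\<lbrakk>x \<in> H; y \<in> H\<rbrakk> \<Longrightarrow> add x y \<in> H"
    and zero_closed: "zero \<in> H"
    and scale_closed: "x \<in> H \<Longrightarrow> smul r x \<in> H"
    and add_assoc: "\<lbrakk>x \<in> H; y \<in> H; z \<in> H\<rbrakk> \<Longrightarrow> add (add x y) z = add x (add y z)"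
    and add_commute: "\<lbrakk>x \<in> H; y \<in> H\<rbrakk> \<Longrightarrow> add x y = add y x"
    and add_zero: "x \<in> H \<Longrightarrow> add zero x = x"
    and add_minus: "x \<in> H \<Longrightarrow> add x (smul (-1) x) = zero"
    and scale_add_right: "\<lbrakk>x \<in> H; y \<in> H\<rbrakk> \<Longrightarrow> smul r (add x y) = add (smul r x) (smul r y)"
    and scale_add_left: "x \<in> H \<Longrightarrow> smul (r + s) x = add (smul r x) (smul s x)"
    and scale_scale: "x \<in> H \<Longrightarrow> smul r (smul s x) = smul (r * s) x"
    and scale_one: "x \<in> H \<Longrightarrow> smul 1 x = x"
    and ip_commute: "\<lbrakk>x \<in> H; y \<in> H\<rbrakk> \<Longrightarrow> ip x y = ip y x"
    and ip_add: "\<lbrakk>x \<in> H; y \<in> H; z \<in> H\<rbrakk> \<Longrightarrow> ip (add x y) z = ip x z + ip y z"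
    and ip_scale: "\<lbrakk>x \<in> H; y \<in> H\<rbrakk> \<Longrightarrow> ip (smul r x) y = r * ip x y"
    and ip_nonneg: "x \<in> H \<Longrightarrow> 0 \<le> ip x x"
    and ip_eq_zero: "x \<in> H \<Longrightarrow> ip x x = 0 \<longleftrightarrow> x = zero"
    \<comment> \<open>\<open>d\<close> is the metric of the norm; its value off the carrier only serves the conventions of
       \<^locale>\<open>Metric_space\<close>.\<close>
    and dist_ip: "d x y = (if x \<in> H \<and> y \<in> H
                           then sqrt (ip (add x (smul (-1) y)) (add x (smul (-1) y))) else 0)"
    and complete: "Metric_space.mcomplete H d"
begin

lemma ip_add_add:
  assumes "x \<in> H" "y \<in> H"
  shows "ip (add x (smul t y)) (add x (smul t y)) = ip x x + 2 * t * ip x y + t\<^sup>2 * ip y y"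
proof -
  have c: "smul t y \<in> H" "add x (smul t y) \<in> H"
    using assms by (auto intro: scale_closed add_closed)
  have 1: "ip x (add x (smul t y)) = ip x x + t * ip x y"
    using assms c by (metis ip_add ip_commute ip_scale)
  have 2: "ip (smul t y) (add x (smul t y)) = t * (ip x y + t * ip y y)"
    using assms c by (metis ip_add ip_commute ip_scale)
  show ?thesis
    using assms c by (simp add: ip_add 1 2 algebra_simps power2_eq_square)
qed

lemma Cauchy_Schwarz:
  assumes "x \<in> H" "y \<in> H"
  shows "(ip x y)\<^sup>2 \<le> ip x x * ip y y"
proof (cases "ip y y = 0")
  case True
  then have y: "y = zero" using assms ip_eq_zero by blast
  have "ip zero x = 0"
    using assms by (metis add_minus ip_add ip_scale scale_closed add.right_inverse mult_minus1)
  then show ?thesis using y assms True by (simp add: ip_commute zero_closed)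
next
  case False
  then have pos: "ip y y > 0" using ip_nonneg[OF assms(2)] by simp
  define t where "t = - ip x y / ip y y"
  have "0 \<le> ip x x + 2 * t * ip x y + t\<^sup>2 * ip y y"
    using ip_add_add[OF assms, of t] ip_nonneg assms by (metis add_closed scale_closed)
  also have "\<dots> = ip x x - (ip x y)\<^sup>2 / ip y y"
    using pos by (simp add: t_def field_simps power2_eq_square)
  finally show ?thesis using pos by (simp add: field_simps)
qed

sublocale Metric_space H d
proof
  show nn: "0 \<le> d x y" for x y
    by (auto simp: dist_ip intro!: ip_nonneg add_closed scale_closed)
  have flip: "add y (smul (-1) x) = smul (-1) (add x (smul (-1) y))" if "x \<in> H" "y \<in> H" for x y
    using that by (simp add: scale_add_right scale_scale scale_one scale_closed add_commute)
  show "d x y = d y x" for x y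
  proof (cases "x \<in> H \<and> y \<in> H")
    case True
    let ?u = "add x (smul (-1) y)"
    have u: "?u \<in> H" using True by (auto intro: add_closed scale_closed)
    have "ip (smul (-1) ?u) (smul (-1) ?u) = ip ?u ?u"
      using u ip_scale[of ?u "smul (-1) ?u" "-1"] ip_scale[of ?u ?u "-1"]
        ip_commute[of ?u "smul (-1) ?u"] scale_closed[of ?u "-1"] by simp
    then show ?thesis using True flip[of x y] unfolding dist_ip by (simp only: if_True simp_thms)
  qed (auto simp: dist_ip)
  have eq: "x = y" if "x \<in> H" "y \<in> H" "add x (smul (-1) y) = zero" for x y
    using that by (metis add_assoc add_commute add_minus add_zero scale_closed)
  show "d x y = 0 \<longleftrightarrow> x = y" if "x \<in> H" "y \<in> H" for x y
    using that eq ip_eq_zero[of "add x (smul (-1) y)"]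
    by (auto simp: dist_ip add_minus add_closed scale_closed)
  show "d x z \<le> d x y + d y z" if xyz: "x \<in> H" "y \<in> H" "z \<in> H" for x y z
  proof -
    let ?u = "add x (smul (-1) y)" and ?v = "add y (smul (-1) z)"
    have u: "?u \<in> H" "?v \<in> H" using xyz by (auto intro: add_closed scale_closed)
    have "add (smul (-1) y) (add y (smul (-1) z)) = smul (-1) z"
      using xyz by (metis add_assoc add_commute add_minus add_zero scale_closed)
    then have w: "add x (smul (-1) z) = add ?u (smul 1 ?v)"
      using xyz u by (simp add: add_assoc scale_closed scale_one add_closed)
    have "\<bar>ip ?u ?v\<bar> \<le> sqrt (ip ?u ?u * ip ?v ?v)"
      using Cauchy_Schwarz[OF u] by (metis real_sqrt_abs real_sqrt_le_iff)
    then have "ip ?u ?u + 2 * 1 * ip ?u ?v + 1\<^sup>2 * ip ?v ?v \<le> (sqrt (ip ?u ?u) + sqrt (ip ?v ?v))\<^sup>2"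
      using ip_nonneg u by (simp add: power2_sum real_sqrt_mult)
    then have "sqrt (ip (add ?u (smul 1 ?v)) (add ?u (smul 1 ?v))) \<le> sqrt (ip ?u ?u) + sqrt (ip ?v ?v)"
      unfolding ip_add_add[OF u, of 1] using ip_nonneg u by (intro real_le_lsqrt) auto
    then show ?thesis using xyz w by (simp add: dist_ip)
  qed
qed

end

definition linear_homeomorphism_onto ::
  "('a::real_normed_vector \<Rightarrow> 'h) \<Rightarrow> 'h set \<Rightarrow> ('h \<Rightarrow> 'h \<Rightarrow> 'h) \<Rightarrow> (real \<Rightarrow> 'h \<Rightarrow> 'h) \<Rightarrow>
   ('h \<Rightarrow> 'h \<Rightarrow> real) \<Rightarrow> bool" where
  "linear_homeomorphism_onto f H add smul d \<longleftrightarrow>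
     (\<forall>x y. f (x + y) = add (f x) (f y)) \<and> (\<forall>r x. f (r *\<^sub>R x) = smul r (f x)) \<and>
     homeomorphic_map euclidean (Metric_space.mtopology H d) f"

text \<open>The Hilbert space \<open>H\<close> may be sought on subsets of the type \<open>'a\<close> itself, because an isomorphism
  is a bijection along which the structure can be transported;
  lemma \<open>isomorphic_to_hilbert_spaceI\<close> below shows that no Hilbert space, over whatever type,
  is missed.\<close>

definition isomorphic_to_hilbert_space :: "'a::real_normed_vector itself \<Rightarrow> bool" where
  "isomorphic_to_hilbert_space (_ :: 'a itself) \<longleftrightarrow>
     (\<exists>(H :: 'a set) add zero smul ip d (f :: 'a \<Rightarrow> 'a).
        real_hilbert_space H add zero smul ip d \<and> linear_homeomorphism_onto f H add smul d)"

lemma isomorphic_to_hilbert_spaceI: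
  fixes f :: "'a::real_normed_vector \<Rightarrow> 'h"
  assumes hs: "real_hilbert_space H add zero smul ip d"
    and lh: "linear_homeomorphism_onto f H add smul d"
  shows "isomorphic_to_hilbert_space TYPE('a)"
proof -
  interpret real_hilbert_space H add zero smul ip d by (rule hs)
  have fa: "\<And>x y. f (x + y) = add (f x) (f y)" and fs: "\<And>r x. f (r *\<^sub>R x) = smul r (f x)"
    and hm: "homeomorphic_map euclidean mtopology f"
    using lh by (auto simp: linear_homeomorphism_onto_def)
  have im: "range f = H"
    using homeomorphic_imp_surjective_map[OF hm] by simp
  have inj: "inj f"
    using homeomorphic_imp_injective_map[OF hm] by simp
  have fH: "f x \<in> H" for x using im by auto
  have f0: "f 0 = zero"
    using fa[of 0 "(-1) *\<^sub>R 0"] fs[of "-1" 0] add_minus[OF fH[of 0]] by simp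
  have dd: "d (f x) (f y) = sqrt (ip (f (x + (-1) *\<^sub>R y)) (f (x + (-1) *\<^sub>R y)))" for x y
    using fH[of x] fH[of y] by (simp only: dist_ip fa fs if_True simp_thms)
  define e where "e = (\<lambda>x y. d (f x) (f y))"
  define j where "j = (\<lambda>x y. ip (f x) (f y))"
  interpret E: Metric_space UNIV e
    by unfold_locales (auto simp: e_def commute fH triangle inj_eq[OF inj])
  interpret M12: Metric_space12 UNIV e H d
    by unfold_locales
  have iso: "homeomorphic_map E.mtopology mtopology f"
    by (rule M12.isometry_imp_homeomorphic_map) (auto simp: im e_def)
  have "homeomorphic_map E.mtopology euclidean (inv f \<circ> f)"
  proof (rule homeomorphic_map_compose[OF iso])
    obtain g where g: "homeomorphic_maps euclidean mtopology f g"
      using hm homeomorphic_map_maps by blast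
    then have "homeomorphic_map mtopology euclidean g"
      using homeomorphic_maps_map by blast
    then show "homeomorphic_map mtopology euclidean (inv f)"
    proof (rule homeomorphic_map_eq)
      fix y assume y: "y \<in> topspace mtopology"
      then show "g y = inv f y"
        using g inj by (simp add: homeomorphic_maps_def) (metis inv_f_eq)
    qed
  qed
  then have "homeomorphic_map E.mtopology euclidean id"
    using inj by simp
  then have id': "homeomorphic_map euclidean E.mtopology id"
    by (simp add: homeomorphic_map_id)
  have comp: "E.mcomplete"
    unfolding E.mcomplete_def
  proof (intro allI impI)
    fix \<sigma> assume s: "E.MCauchy \<sigma>"
    have "MCauchy (f \<circ> \<sigma>)"
      using s fH unfolding E.MCauchy_def MCauchy_def by (auto simp: e_def)
    then obtain l where l: "limitin mtopology (f \<circ> \<sigma>) l sequentially"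
      using complete by (auto simp: mcomplete_def)
    then have "l \<in> H" by (simp add: limitin_metric)
    then obtain x where "l = f x" using im by auto
    with l have "limitin E.mtopology \<sigma> x sequentially"
      unfolding E.limitin_metric limitin_metric by (simp add: e_def fH)
    then show "\<exists>x. limitin E.mtopology \<sigma> x sequentially" ..
  qed
  have "real_hilbert_space UNIV (+) 0 (*\<^sub>R) j e"
  proof
    show "j x y = j y x" for x y by (simp add: j_def ip_commute fH)
    show "j (x + y) z = j x z + j y z" for x y z by (simp add: j_def fa ip_add fH)
    show "j (r *\<^sub>R x) y = r * j x y" for r x y by (simp add: j_def fs ip_scale fH)
    show "0 \<le> j x x" for x by (simp add: j_def ip_nonneg fH)
    show "j x x = 0 \<longleftrightarrow> x = 0" for x
      using inj by (simp add: j_def ip_eq_zero fH flip: f0) (metis injD)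
    show "e x y = (if x \<in> UNIV \<and> y \<in> UNIV then sqrt (j (x + -1 *\<^sub>R y) (x + -1 *\<^sub>R y)) else 0)" for x y
      using dd[of x y] by (simp add: e_def j_def)
  qed (auto simp: comp algebra_simps)
  moreover have "linear_homeomorphism_onto id UNIV (+) (*\<^sub>R) e"
    using id' by (simp add: linear_homeomorphism_onto_def)
  ultimately show ?thesis
    unfolding isomorphic_to_hilbert_space_def by blast
qed

lemma real_hilbert_space_UNIV:
  "real_hilbert_space (UNIV :: 'h::{real_inner,complete_space} set) (+) 0 (*\<^sub>R) inner dist"
proof
  show "Met_TC.mcomplete TYPE('h)" by (simp add: complete_UNIV)
  show "inner x y = inner y x" for x y :: 'h by (rule inner_commute)
  show "dist x y = (if x \<in> UNIV \<and> y \<in> UNIV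
      then sqrt (inner (x + -1 *\<^sub>R y) (x + -1 *\<^sub>R y)) else 0)" for x y :: 'h
    by (simp add: dist_norm norm_eq_sqrt_inner)
qed (auto simp: algebra_simps inner_add_left)

definition positive_operator :: "('a::real_normed_vector \<Rightarrow> ('a \<Rightarrow>\<^sub>L real)) \<Rightarrow> bool" where
  "positive_operator T \<longleftrightarrow> linear T \<and> (\<forall>x. 0 \<le> blinfun_apply (T x) x)"

text \<open>\<^const>\<open>Blinfun\<close> is only meaningful on bounded linear functions; for positive operators on Banach
  spaces this is automatic, see lemma \<open>adjoint_on_apply\<close> below.\<close>

definition adjoint_on :: "('a::real_normed_vector \<Rightarrow> ('a \<Rightarrow>\<^sub>L real)) \<Rightarrow> 'a \<Rightarrow> ('a \<Rightarrow>\<^sub>L real)" where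
  "adjoint_on T x = Blinfun (\<lambda>y. blinfun_apply (T y) x)"

text \<open>For \<open>T = 0\<close> the infimum is over the empty set, and \<open>operator_cos T\<close> is an unspecified real number.\<close>

definition operator_cos :: "('a::real_normed_vector \<Rightarrow> ('a \<Rightarrow>\<^sub>L real)) \<Rightarrow> real" where
  "operator_cos T = Inf {blinfun_apply (T x) x / (norm (T x) * norm x) | x. x \<noteq> 0 \<and> T x \<noteq> 0}"

lemma positive_operator_bounded:
  fixes T :: "'a::banach \<Rightarrow> ('a \<Rightarrow>\<^sub>L real)"
  assumes "positive_operator T"
  shows "bounded_linear T"
proof -
  have lin: "linear T" and pos: "\<And>x. 0 \<le> blinfun_apply (T x) x"
    using assms by (auto simp: positive_operator_def)
  define F where "F = (\<lambda>n::nat. \<Inter>y\<in>cball 0 1. {x. blinfun_apply (T y) (x - y) \<le> real n})"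
  have clF: "closed (F n)" for n
    unfolding F_def by (intro closed_INT ballI closed_Collect_le continuous_intros)
  have mono: "T y (x - y) \<le> norm (T x) * (norm x + 1)" if "norm y \<le> 1" for x y
  proof -
    have "0 \<le> T (x - y) (x - y)" by (rule pos)
    then have "T y (x - y) \<le> T x (x - y)"
      by (simp add: linear_diff[OF lin] blinfun.diff_left)
    also have "\<dots> \<le> norm (T x) * norm (x - y)"
      by (metis abs_le_D1 norm_blinfun real_norm_def)
    also have "\<dots> \<le> norm (T x) * (norm x + 1)"
      using that norm_triangle_ineq4[of x y] by (intro mult_left_mono) auto
    finally show ?thesis .
  qed
  have cover: "\<exists>n. x \<in> F n" for x
  proof -
    obtain n where "norm (T x) * (norm x + 1) \<le> real n"
      using real_arch_simple by blast
    then have "x \<in> F n"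
      using order_trans[OF mono[of _ x]] unfolding F_def by auto
    then show ?thesis ..
  qed
  have "\<exists>n. interior (F n) \<noteq> {}"
  proof (rule ccontr)
    assume "\<nexists>n. interior (F n) \<noteq> {}"
    then have "Met_TC.mtopology interior_of \<Union>(range F) = {}"
      by (intro Met_TC.metric_Baire_category_alt) (auto simp: clF complete_UNIV)
    moreover have "\<Union>(range F) = UNIV" using cover by auto
    ultimately show False by simp
  qed
  then obtain n x0 where "x0 \<in> interior (F n)" by auto
  then obtain r where r: "r > 0" "cball x0 r \<subseteq> F n"
    by (meson interior_subset mem_interior_cball)
  obtain m where m: "- x0 \<in> F m" using cover by blast
  define M where "M = real n + real m"
  have M0: "M \<ge> 0" by (simp add: M_def)
  have key: "T y (z - 2 *\<^sub>R y) \<le> M" if "norm z \<le> r" "norm y \<le> 1" for y z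
  proof -
    have "x0 + z \<in> F n" using r(2) that by (auto simp: dist_norm)
    then have "T y (x0 + z - y) \<le> real n" using that by (auto simp: F_def)
    moreover have "T y (- x0 - y) \<le> real m" using m that by (auto simp: F_def)
    moreover have "z - 2 *\<^sub>R y = (x0 + z - y) + (- x0 - y)" by (simp add: scaleR_2)
    ultimately show ?thesis unfolding M_def by (simp only: blinfun.add_right)
  qed
  define s where "s = min 1 (r / 4)"
  have s: "s > 0" "s \<le> 1" "s \<le> r / 4" using r by (auto simp: s_def)
  have bnd: "norm (T y) \<le> 2 * M / r" if y: "norm y \<le> s" for y
  proof -
    have up: "T y z \<le> M + r / 2 * norm (T y)" if "norm z \<le> r" for z
    proof -
      have "T y z \<le> M + 2 * T y y"
        using key[OF that, of y] y s by (simp add: blinfun.diff_right blinfun.scaleR_right)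
      also have "T y y \<le> norm (T y) * norm y"
        by (metis abs_le_D1 norm_blinfun real_norm_def)
      also have "\<dots> \<le> norm (T y) * (r / 4)"
        using y s by (intro mult_left_mono) auto
      finally show ?thesis by simp
    qed
    have "norm (T y) \<le> (M + r / 2 * norm (T y)) / r"
    proof (rule norm_blinfun_bound)
      show "0 \<le> (M + r / 2 * norm (T y)) / r" using M0 r by simp
      fix z
      show "norm (T y z) \<le> (M + r / 2 * norm (T y)) / r * norm z"
      proof (cases "z = 0")
        case False
        have "\<bar>T y ((r / norm z) *\<^sub>R z)\<bar> \<le> M + r / 2 * norm (T y)"
          using up[of "(r / norm z) *\<^sub>R z"] up[of "- ((r / norm z) *\<^sub>R z)"] False r
          by (auto simp: blinfun.minus_right)
        then show ?thesis
          using False r by (simp add: blinfun.scaleR_right abs_mult field_simps)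
      qed simp
    qed
    then show ?thesis using r by (simp add: field_simps)
  qed
  show ?thesis
  proof (rule bounded_linear.intro[OF lin], unfold_locales, intro exI allI)
    fix x
    show "norm (T x) \<le> norm x * (2 * M / r / s)"
    proof (cases "x = 0")
      case False
      have "norm (T ((s / norm x) *\<^sub>R x)) \<le> 2 * M / r"
        using False s by (intro bnd) simp
      then have "s / norm x * norm (T x) \<le> 2 * M / r"
        using s by (simp add: linear_scale[OF lin])
      then show ?thesis using False s r by (simp add: field_simps)
    qed (simp add: linear_0[OF lin])
  qed
qed

lemma adjoint_on_apply:
  fixes T :: "'a::banach \<Rightarrow> ('a \<Rightarrow>\<^sub>L real)"
  assumes "positive_operator T"
  shows "blinfun_apply (adjoint_on T x) y = blinfun_apply (T y) x"
proof -
  have "bounded_linear (\<lambda>y. blinfun_apply (T y) x)"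
    using bounded_linear_compose[OF blinfun.bounded_linear_left positive_operator_bounded[OF assms]] .
  then show ?thesis by (simp add: adjoint_on_def bounded_linear_Blinfun_apply)
qed

end

theory Submission
  imports Defs
begin

text \<open>Suppose \<open>\<delta> = cos T > 0\<close>, so that \<open>\<langle>Tx,x\<rangle> \<ge> \<delta> \<parallel>Tx\<parallel> \<parallel>x\<parallel>\<close> for every \<open>x\<close>.
  The idea is to show that \<open>T\<close> is bounded below, \<open>\<parallel>Tx\<parallel> \<ge> m \<parallel>x\<parallel>\<close> with \<open>m > 0\<close>.
  Then \<open>\<langle>Tx,x\<rangle> \<ge> \<delta> m \<parallel>x\<parallel>\<^sup>2\<close>, so the symmetric part of the form \<open>\<langle>Tx,y\<rangle>\<close> is an inner product
  whose norm is equivalent to that of \<open>X\<close>, and \<open>X\<close> is isomorphic to a Hilbert space.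

  If \<open>T\<close> were not bounded below, there would be unit vectors \<open>x\<close> with \<open>\<parallel>Tx\<parallel>\<close> arbitrarily small.
  Fix \<open>y\<close> with \<open>Ty \<noteq> 0\<close> and look at \<open>x + \<epsilon>y\<close>. In
  \<open>\<langle>T(x + \<epsilon>y), x + \<epsilon>y\<rangle> = \<langle>Tx,x\<rangle> + \<epsilon>\<langle>Tx,y\<rangle> + \<epsilon>\<langle>Ty,x\<rangle> + \<epsilon>\<^sup>2\<langle>Ty,y\<rangle>\<close>
  the first two terms are small because \<open>Tx\<close> is, and the third one because
  \<open>\<langle>Ty,x\<rangle> = \<langle>T\<^sup>*x,y\<rangle>\<close> and \<open>\<parallel>T\<^sup>*x\<parallel> \<le> c \<parallel>Tx\<parallel>\<close>. What is left is of order \<open>\<epsilon>\<^sup>2\<close>,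
  whereas \<open>\<parallel>T(x + \<epsilon>y)\<parallel> \<parallel>x + \<epsilon>y\<parallel>\<close> is of order \<open>\<epsilon>\<close>: for small \<open>\<epsilon>\<close> this contradicts \<open>\<delta> > 0\<close>.
  Lemma \<open>bounded_below_if_cos_pos\<close> is the quantitative form of this argument, and
  \<open>isomorphic_to_hilbert_space_if_coercive\<close> the passage from a coercive form to a Hilbert space.\<close>

text \<open>Bilinearity makes \<open>sqrt (b x x)\<close> at most a multiple of the norm, coercivity makes it at least
  one. Hence the inner product \<open>b\<close> on the whole space has the same Cauchy sequences and the same
  open sets as the norm, and the identity is the required isomorphism.\<close>

lemma isomorphic_to_hilbert_space_if_coercive:
  fixes b :: "'a::banach \<Rightarrow> 'a \<Rightarrow> real"
  assumes bil: "bounded_bilinear b" and sym: "\<And>x y. b x y = b y x"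
    and \<alpha>: "\<alpha> > 0" and coercive: "\<And>x. \<alpha> * (norm x)\<^sup>2 \<le> b x x"
  shows "isomorphic_to_hilbert_space TYPE('a)"
proof -
  interpret b: bounded_bilinear b by (rule bil)
  define e where "e = (\<lambda>x y. sqrt (b (x - y) (x - y)))"
  obtain K where K: "K > 0" "\<And>x y. norm (b x y) \<le> norm x * norm y * K"
    using b.pos_bounded by blast
  have nonneg: "0 \<le> b x x" for x
    using order_trans[OF _ coercive[of x]] \<alpha> by simp
  have definite: "b x x = 0 \<longleftrightarrow> x = 0" for x
    using coercive[of x] \<alpha> by (auto simp: b.zero_left mult_le_0_iff)
  have e_le: "e x y \<le> sqrt K * dist x y" for x y
    using K(2)[of "x - y" "x - y"] nonneg[of "x - y"] K(1)
    by (auto simp: e_def dist_norm power_mult_distrib power2_eq_square[of "norm _"] mult_ac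
        intro!: real_le_lsqrt)
  have le_e: "sqrt \<alpha> * dist x y \<le> e x y" for x y
    using coercive[of "x - y"] \<alpha>
    by (auto simp: e_def dist_norm power_mult_distrib intro!: real_le_rsqrt)
  have triangle: "e x z \<le> e x y + e y z" for x y z
  proof -
    define u v p q where "u = x - y" and "v = y - z"
      and "p = sqrt (b u u)" and "q = sqrt (b v v)"
    have pq: "p \<ge> 0" "q \<ge> 0" "b u u = p\<^sup>2" "b v v = q\<^sup>2"
      using nonneg by (simp_all add: p_def q_def)
    \<comment> \<open>Cauchy--Schwarz: \<open>qu - pv\<close> is the combination whose square is \<open>2pq(pq - b u v)\<close>.\<close>
    have uv: "b u v \<le> p * q"
    proof (cases "u = 0 \<or> v = 0")
      case True
      then show ?thesis using pq by (auto simp: b.zero_left b.zero_right)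
    next
      case False
      then have "p * q > 0"
        using definite nonneg by (simp add: p_def q_def less_le)
      have "0 \<le> b (q *\<^sub>R u - p *\<^sub>R v) (q *\<^sub>R u - p *\<^sub>R v)" by (rule nonneg)
      also have "\<dots> = q\<^sup>2 * b u u - 2 * (p * q * b u v) + p\<^sup>2 * b v v"
        by (simp add: b.diff_left b.diff_right b.scaleR_left b.scaleR_right
            sym[of v u] power2_eq_square algebra_simps)
      also have "\<dots> = 2 * (p * q) * (p * q - b u v)"
        by (simp add: pq power2_eq_square algebra_simps)
      finally show ?thesis using \<open>p * q > 0\<close> by (simp add: zero_le_mult_iff)
    qed
    have "b (u + v) (u + v) = b u u + 2 * b u v + b v v"
      by (simp add: b.add_left b.add_right sym[of v u])
    also have "\<dots> \<le> (p + q)\<^sup>2" using uv by (simp add: pq power2_sum)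
    finally have "sqrt (b (u + v) (u + v)) \<le> p + q"
      using pq by (intro real_le_lsqrt) auto
    then show ?thesis by (simp add: e_def u_def v_def p_def q_def)
  qed
  interpret E: Metric_space UNIV e
  proof
    show "0 \<le> e x y" for x y by (simp add: e_def nonneg)
    show "e x y = e y x" for x y
      using b.minus_left[of "y - x" "x - y"] b.minus_right[of "y - x" "y - x"]
      by (simp add: e_def)
    show "e x y = 0 \<longleftrightarrow> x = y" for x y by (simp add: e_def definite)
  qed (rule triangle)
  have ball_e: "\<exists>s>0. E.mball x s \<subseteq> ball x r" if "r > 0" for x r
  proof (intro exI conjI subsetI)
    show "sqrt \<alpha> * r > 0" using \<alpha> that by simp
    fix y assume "y \<in> E.mball x (sqrt \<alpha> * r)"
    then have "sqrt \<alpha> * dist x y < sqrt \<alpha> * r" using le_e[of x y] by simp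
    then show "y \<in> ball x r" using \<alpha> by simp
  qed
  have ball_dist: "\<exists>s>0. ball x s \<subseteq> E.mball x r" if "r > 0" for x r
  proof (intro exI conjI subsetI)
    show "r / sqrt K > 0" using K(1) that by simp
    fix y assume "y \<in> ball x (r / sqrt K)"
    then have "sqrt K * dist x y < r" using K(1) by (simp add: field_simps)
    then show "y \<in> E.mball x r" using e_le[of x y] by simp
  qed
  have top: "E.mtopology = euclidean"
  proof (rule topology_eq[THEN iffD2], intro allI)
    fix U
    show "openin E.mtopology U \<longleftrightarrow> openin euclidean U"
      unfolding E.openin_mtopology open_openin[symmetric] open_contains_ball
      using ball_e ball_dist by (meson order_trans subset_UNIV)
  qed
  have "E.mcomplete"
    unfolding E.mcomplete_def
  proof (intro allI impI)
    fix \<sigma> assume \<sigma>: "E.MCauchy \<sigma>"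
    have "Cauchy \<sigma>"
    proof (rule metric_CauchyI)
      fix r :: real assume "r > 0"
      then have "sqrt \<alpha> * r > 0" using \<alpha> by simp
      then obtain N where N: "\<And>m n. N \<le> m \<Longrightarrow> N \<le> n \<Longrightarrow> e (\<sigma> m) (\<sigma> n) < sqrt \<alpha> * r"
        using \<sigma> unfolding E.MCauchy_def by meson
      have "dist (\<sigma> m) (\<sigma> n) < r" if "N \<le> m" "N \<le> n" for m n
        using le_less_trans[OF le_e N[OF that]] \<alpha> by simp
      then show "\<exists>N. \<forall>m\<ge>N. \<forall>n\<ge>N. dist (\<sigma> m) (\<sigma> n) < r" by blast
    qed
    then obtain l where "\<sigma> \<longlonglongrightarrow> l" using Cauchy_convergent convergent_def by blast
    then show "\<exists>l. limitin E.mtopology \<sigma> l sequentially"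
      unfolding top by auto
  qed
  then have "real_hilbert_space UNIV (+) 0 (*\<^sub>R) b e"
    by unfold_locales
      (auto simp: sym nonneg definite e_def b.add_left b.add_right b.scaleR_left b.scaleR_right
        algebra_simps)
  moreover have "linear_homeomorphism_onto id UNIV (+) (*\<^sub>R) e"
    by (simp add: linear_homeomorphism_onto_def top)
  ultimately show ?thesis
    by (rule isomorphic_to_hilbert_spaceI)
qed

text \<open>For a unit vector \<open>x\<close> the test vector \<open>x + \<epsilon>y\<close> turns the angle condition into
  \<open>\<delta>(\<epsilon>\<parallel>Ty\<parallel> - \<parallel>Tx\<parallel>)/2 \<le> (1 + \<epsilon> + \<epsilon>c)\<parallel>Tx\<parallel> + \<epsilon>\<^sup>2\<parallel>Ty\<parallel>\<close> with \<open>\<parallel>y\<parallel> = 1\<close>, which is solved for \<open>\<parallel>Tx\<parallel>\<close>.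
  Since \<open>x\<close> may lie in the kernel of \<open>T\<close>, this includes injectivity. The assumption \<open>adj\<close> is the bound
  on the adjoint, written as a bound on the form.\<close>

lemma bounded_below_if_cos_pos:
  fixes T :: "'a::real_normed_vector \<Rightarrow> ('a \<Rightarrow>\<^sub>L real)"
  assumes lin: "linear T" and \<delta>: "\<delta> > 0"
    and angle: "\<And>x. \<delta> * (norm (T x) * norm x) \<le> T x x"
    and c: "c > 0" and adj: "\<And>x y. \<bar>T y x\<bar> \<le> c * norm (T x) * norm y"
    and "T z \<noteq> 0"
  obtains m where "m > 0" "\<And>x. m * norm x \<le> norm (T x)"
proof -
  define y where "y = z /\<^sub>R norm z"
  have "z \<noteq> 0" using \<open>T z \<noteq> 0\<close> linear_0[OF lin] by auto
  then have y: "norm y = 1" and Ty: "norm (T y) > 0"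
    using \<open>T z \<noteq> 0\<close> by (auto simp: y_def linear_scale[OF lin])
  \<comment> \<open>The term of order \<open>\<epsilon>\<^sup>2\<close> is to take up at most half of the gain \<open>\<delta>\<epsilon>\<parallel>Ty\<parallel>/2\<close>,
     and \<open>\<epsilon> \<le> 1/2\<close> keeps \<open>x + \<epsilon>y\<close> of norm at least \<open>1/2\<close>.\<close>
  define \<epsilon> where "\<epsilon> = min (1/2) (\<delta>/4)"
  have \<epsilon>: "\<epsilon> > 0" "\<epsilon> \<le> 1/2" "\<epsilon> \<le> \<delta>/4" using \<delta> by (auto simp: \<epsilon>_def)
  define D where "D = \<delta>/2 + 1 + \<epsilon> + \<epsilon> * c"
  define m where "m = \<epsilon> * norm (T y) * \<delta> / 4 / D"
  have D: "D > 0" using \<delta> \<epsilon> c by (simp add: D_def add_pos_pos)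
  have unit: "m \<le> norm (T x)" if x: "norm x = 1" for x
  proof -
    let ?w = "x + \<epsilon> *\<^sub>R y" and ?a = "norm (T x)"
    have apply_le: "T u v \<le> norm (T u) * norm v" for u v
      by (metis abs_le_D1 norm_blinfun real_norm_def)
    have Tw: "T ?w = T x + \<epsilon> *\<^sub>R T y"
      by (simp add: linear_add[OF lin] linear_scale[OF lin])
    have "\<epsilon> * norm (T y) - ?a \<le> norm (T ?w)"
      using norm_triangle_ineq2[of "\<epsilon> *\<^sub>R T y" "- T x"] \<epsilon>(1) by (simp add: Tw add.commute)
    moreover have "1/2 \<le> norm ?w"
      using norm_triangle_ineq2[of x "- (\<epsilon> *\<^sub>R y)"] x y \<epsilon> by simp
    then have "norm (T ?w) * (1/2) \<le> norm (T ?w) * norm ?w"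
      by (intro mult_left_mono) auto
    ultimately have "(\<epsilon> * norm (T y) - ?a) / 2 \<le> norm (T ?w) * norm ?w"
      by simp
    then have "\<delta> * ((\<epsilon> * norm (T y) - ?a) / 2) \<le> T ?w ?w"
      using angle[of ?w] \<delta> by (meson mult_left_mono less_imp_le order_trans)
    also have "\<dots> = T x x + \<epsilon> * T x y + \<epsilon> * T y x + \<epsilon> * (\<epsilon> * T y y)"
      by (simp add: Tw blinfun.add_left blinfun.add_right blinfun.scaleR_left
          blinfun.scaleR_right algebra_simps)
    also have "\<dots> \<le> ?a + \<epsilon> * ?a + \<epsilon> * (c * ?a) + \<epsilon> * (\<delta>/4 * norm (T y))"
    proof (intro add_mono mult_left_mono)
      show "T x x \<le> ?a" "T x y \<le> ?a" using apply_le[of x x] apply_le[of x y] x y by simp_all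
      show "T y x \<le> c * ?a" using adj[of y x] y by simp
      have "T y y \<le> norm (T y)" using apply_le[of y y] y by simp
      then show "\<epsilon> * T y y \<le> \<delta>/4 * norm (T y)"
        using \<epsilon> \<delta> Ty by (intro order_trans[OF mult_left_mono mult_right_mono]) auto
    qed (use \<epsilon> in auto)
    finally have "\<epsilon> * norm (T y) * \<delta> / 4 \<le> ?a * D"
      by (simp add: D_def field_simps)
    then show ?thesis using D by (simp add: m_def pos_divide_le_eq)
  qed
  show ?thesis
  proof
    show "m > 0" using D \<epsilon>(1) Ty \<delta> by (simp add: m_def)
    show "m * norm x \<le> norm (T x)" for x
    proof (cases "x = 0")
      case False
      then show ?thesis
        using unit[of "x /\<^sub>R norm x"] by (simp add: linear_scale[OF lin] field_simps)
    qed (simp add: linear_0[OF lin])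
  qed
qed

theorem theorem4p5:
  fixes T :: "'a::banach \<Rightarrow> ('a \<Rightarrow>\<^sub>L real)"
  assumes "\<not> isomorphic_to_hilbert_space TYPE('a)"
    and "positive_operator T"
    and "T \<noteq> (\<lambda>x. 0)"
    and "\<exists>c::real>0. \<forall>x. norm (adjoint_on T x) \<le> c * norm (T x)"
  shows "operator_cos T = 0"
proof -
  have lin: "linear T" and pos: "\<And>x. 0 \<le> T x x"
    using assms(2) by (auto simp: positive_operator_def)
  obtain c where c: "c > 0" "\<And>x. norm (adjoint_on T x) \<le> c * norm (T x)"
    using assms(4) by blast
  obtain z where z: "T z \<noteq> 0" using assms(3) by auto
  have adj: "\<bar>T y x\<bar> \<le> c * norm (T x) * norm y" for x y
  proof -
    have "\<bar>T y x\<bar> \<le> norm (adjoint_on T x) * norm y"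
      using norm_blinfun[of "adjoint_on T x" y] by (simp add: adjoint_on_apply[OF assms(2)])
    also have "\<dots> \<le> c * norm (T x) * norm y" using c(2) by (intro mult_right_mono) auto
    finally show ?thesis .
  qed
  define Q where "Q = {T x x / (norm (T x) * norm x) | x. x \<noteq> 0 \<and> T x \<noteq> 0}"
  have Q: "Q \<noteq> {}" "\<And>q. q \<in> Q \<Longrightarrow> 0 \<le> q"
    using z linear_0[OF lin] pos by (force simp: Q_def)+
  have cos: "operator_cos T = Inf Q" by (simp add: operator_cos_def Q_def)
  have "\<not> 0 < Inf Q"
  proof
    assume \<delta>: "0 < Inf Q"
    have angle: "Inf Q * (norm (T x) * norm x) \<le> T x x" for x
    proof (cases "x = 0 \<or> T x = 0")
      case False
      then have "Inf Q \<le> T x x / (norm (T x) * norm x)"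
        using Q(2) by (intro cInf_lower bdd_belowI) (auto simp: Q_def)
      then show ?thesis using False by (simp add: pos_le_divide_eq)
    qed auto
    obtain m where m: "m > 0" "\<And>x. m * norm x \<le> norm (T x)"
      using bounded_below_if_cos_pos[OF lin \<delta> angle c(1) adj z] by blast
    define b where "b = (\<lambda>x y. (T x y + T y x) / 2)"
    interpret T: bounded_bilinear "\<lambda>x y. blinfun_apply (T x) y"
      by (rule bounded_bilinear.comp1[OF bounded_bilinear_blinfun_apply
            positive_operator_bounded[OF assms(2)]])
    have "bounded_bilinear b"
    proof
      obtain K where K: "\<And>x y. norm (T x y) \<le> norm x * norm y * K"
        using T.bounded by blast
      have "norm (b x y) \<le> norm x * norm y * K" for x y
        using K[of x y] K[of y x] by (simp add: b_def mult.commute)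
      then show "\<exists>K. \<forall>x y. norm (b x y) \<le> norm x * norm y * K" by blast
    qed (simp_all add: b_def T.add_left T.add_right T.scaleR_left T.scaleR_right
        field_simps)
    moreover have "b x y = b y x" for x y by (simp add: b_def)
    moreover have "0 < Inf Q * m" using \<delta> m(1) by simp
    moreover have "(Inf Q * m) * (norm x)\<^sup>2 \<le> b x x" for x
    proof -
      have "Inf Q * (m * norm x * norm x) \<le> Inf Q * (norm (T x) * norm x)"
        using \<delta> m(2) by (intro mult_left_mono mult_right_mono) auto
      then show ?thesis
        using angle[of x] by (simp add: b_def power2_eq_square mult_ac)
    qed
    ultimately show False
      using isomorphic_to_hilbert_space_if_coercive assms(1) by blast
  qed
  moreover have "0 \<le> Inf Q" using Q by (intro cInf_greatest) auto
  ultimately show ?thesis using cos by simp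
qed

end
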